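(* There exists a universal covering (in the sense defined in the context) whose area is at most $0.8441153$.
   Context: For a set $A \subseteq \mathbb{R}^2$, its diameter is $\mathrm{diam}(A) = \sup\{d(x,y) : x,y \in A\}$, where $d$ is the Euclidean distance. A universal covering is a convex set $U \subseteq \mathbb{R}^2$ such that every set $A \subseteq \mathbb{R}^2$ with $\mathrm{diam}(A) = 1$ is isometric to some subset $B \subseteq U$. Here isometric means related by a Euclidean isometry of the plane, i.e. a composition of translations, rotations and reflections. Area means Lebesgue measure in $\mathbb{R}^2$. *)

theory Defs
  imports "HOL-Analysis.Analysis"
begin

text \<open>Diameter as a supremum in the extended reals (so an unbounded set has diameter \<infinity>).\<close>
definition diam :: "(real^2) set \<Rightarrow> ereal" where
  "diam A = (SUP p \<in> A \<times> A. ereal (dist (fst p) (snd p)))"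

definition plane_isometry :: "(real^2 \<Rightarrow> real^2) \<Rightarrow> bool" where
  "plane_isometry f \<longleftrightarrow> bij f \<and> (\<forall>x y. dist (f x) (f y) = dist x y)"

definition universal_covering :: "(real^2) set \<Rightarrow> bool" where
  "universal_covering U \<longleftrightarrow> convex U \<and>
     (\<forall>A. diam A = 1 \<longrightarrow> (\<exists>f. plane_isometry f \<and> f ` A \<subseteq> U))"

end

theory Submission
  imports Defs
begin

text \<open>
  A set of diameter 1 lies in a body \<open>K\<close> of constant width 1, and \<open>K\<close> has a circumscribed regular
  hexagon \<open>ABCDEF\<close> (labelled counterclockwise) of width 1. Fix a small slant \<open>s\<close>. For a corner \<open>X\<close> in
  direction \<open>\<theta>\<close> let \<open>X+\<close> and \<open>X-\<close> be the triangles cut off at \<open>X\<close> by the lines at distance \<open>1/2\<close> from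
  the centre with normal direction \<open>\<theta> + s\<close> and \<open>\<theta> - s\<close>. The lines of opposite corners are at distance
  1, so \<open>K\<close> enters at most one of two opposite \<open>X+\<close>, and likewise for \<open>X-\<close>.

  As in Pal's argument one may rotate so that \<open>K\<close> avoids \<open>C+\<close> and \<open>E+\<close>. Then \<open>K\<close> avoids \<open>A-\<close>, or it
  avoids \<open>E-\<close>, or it avoids both \<open>B-\<close> and \<open>D-\<close>. In the last case the reflection that exchanges
  \<open>B, E\<close> and \<open>C, D\<close> preserves the assumptions, so the contact point of \<open>K\<close> with \<open>CD\<close> may be taken in
  the half next to \<open>D\<close>. Since \<open>K\<close> lies in the unit disc about each of its points, the avoided triangles
  bound the contact points with \<open>CD\<close> and \<open>DE\<close> away from \<open>C\<close> and \<open>E\<close>, and this cuts off a region near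
  \<open>A\<close>. The cover is a polygon circumscribed about what remains.
\<close>

section \<open>Completion to constant width\<close>

definition constant_width :: "real \<Rightarrow> 'a::real_normed_vector set \<Rightarrow> bool" where
  "constant_width d K \<longleftrightarrow>
     (\<forall>x\<in>K. \<forall>y\<in>K. dist x y \<le> d) \<and> (\<forall>n. norm n = 1 \<longrightarrow> (\<exists>p\<in>K. p + d *\<^sub>R n \<in> K))"

lemma constant_width_dist_le: "constant_width d K \<Longrightarrow> x \<in> K \<Longrightarrow> y \<in> K \<Longrightarrow> dist x y \<le> d"
  by (simp add: constant_width_def)

lemma constant_width_chord:
  assumes "constant_width d K" "norm n = 1"
  obtains p where "p \<in> K" "p + d *\<^sub>R n \<in> K"
  using assms by (auto simp: constant_width_def)

definition diametrically_complete :: "real \<Rightarrow> 'a::metric_space set \<Rightarrow> bool" where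
  "diametrically_complete d K \<longleftrightarrow> K = (\<Inter>x\<in>K. cball x d)"

lemma diametrically_complete_dist_le:
  "diametrically_complete d K \<Longrightarrow> x \<in> K \<Longrightarrow> y \<in> K \<Longrightarrow> dist x y \<le> d"
  unfolding diametrically_complete_def by (metis INT_E mem_cball)

lemma diametrically_complete_memI:
  "diametrically_complete d K \<Longrightarrow> (\<And>x. x \<in> K \<Longrightarrow> dist x z \<le> d) \<Longrightarrow> z \<in> K"
  unfolding diametrically_complete_def by (metis INT_I mem_cball)

lemma diametrically_complete_nonempty: "diametrically_complete d K \<Longrightarrow> K \<noteq> {}"
  by (auto simp: diametrically_complete_def)

lemma diametrically_complete_compact:
  fixes K :: "'a::heine_borel set"
  assumes K: "diametrically_complete d K"
  shows "compact K"
proof -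
  have "closed (\<Inter>x\<in>K. cball x d)"
    by (intro closed_INT ballI closed_cball)
  then have "closed K"
    using K by (simp add: diametrically_complete_def)
  moreover have "bounded K"
    using diametrically_complete_dist_le[OF K] unfolding bounded_two_points by blast
  ultimately show ?thesis
    by (simp add: compact_eq_bounded_closed)
qed

lemma diametrically_complete_extension:
  fixes A :: "'a::metric_space set"
  assumes "0 \<le> d" and diameter_A: "\<And>x y. x \<in> A \<Longrightarrow> y \<in> A \<Longrightarrow> dist x y \<le> d"
  obtains K where "A \<subseteq> K" "diametrically_complete d K"
proof -
  define \<A> where "\<A> = {K. A \<subseteq> K \<and> (\<forall>x\<in>K. \<forall>y\<in>K. dist x y \<le> d)}"
  have "\<A> \<noteq> {}"
    using diameter_A by (auto simp: \<A>_def)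
  moreover have "\<Union>\<C> \<in> \<A>" if chain: "\<C> \<noteq> {}" "subset.chain \<A> \<C>" for \<C>
  proof -
    have \<C>: "\<C> \<subseteq> \<A>"
      using chain by (simp add: subset_chain_def)
    have "dist x y \<le> d" if xy: "x \<in> \<Union>\<C>" "y \<in> \<Union>\<C>" for x y
    proof -
      obtain B where "B \<in> \<C>" "{x, y} \<subseteq> B"
        using finite_subset_Union_chain[of "{x, y}" \<C> \<A>] xy chain by blast
      then show ?thesis
        using \<C> by (auto simp: \<A>_def)
    qed
    moreover have "A \<subseteq> \<Union>\<C>"
      using \<C> \<open>\<C> \<noteq> {}\<close> by (auto simp: \<A>_def)
    ultimately show ?thesis
      by (simp add: \<A>_def)
  qed
  ultimately obtain K where K: "K \<in> \<A>" and maximal: "\<And>X. X \<in> \<A> \<Longrightarrow> K \<subseteq> X \<Longrightarrow> X = K"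
    using subset_Zorn_nonempty[of \<A>] by blast
  have "z \<in> K" if "\<And>x. x \<in> K \<Longrightarrow> dist x z \<le> d" for z
  proof -
    have "insert z K \<in> \<A>"
      using K that \<open>0 \<le> d\<close> by (auto simp: \<A>_def dist_commute)
    then show ?thesis
      using maximal by blast
  qed
  then have "diametrically_complete d K"
    using K by (auto simp: \<A>_def diametrically_complete_def)
  then show thesis
    using that K by (auto simp: \<A>_def)
qed

text \<open>
  The points common to all balls of radius \<open>d\<close> through \<open>0\<close> and \<open>u\<close> form a spindle with tips \<open>0\<close> and
  \<open>u\<close>, which bulges out of the segment in every direction orthogonal to it. A diametrically complete set
  contains the spindle of any two of its points, so it lies in the ball of radius \<open>d\<close> that rests on its
  supporting hyperplane at a lowest point.
\<close>
lemma spindle_mem: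
  fixes u n :: "'a::real_inner"
  assumes unit_n: "norm n = 1" and \<sigma>: "0 \<le> \<sigma>" and t: "0 \<le> t" "t \<le> 1"
    and room: "t * (norm (u - \<sigma> *\<^sub>R n))\<^sup>2 \<le> (norm u)\<^sup>2 - 2 * d * \<sigma>"
    and balls: "norm c \<le> d" "norm (c - u) \<le> d"
  shows "norm (c - t *\<^sub>R (u - \<sigma> *\<^sub>R n)) \<le> d"
proof -
  have inner_c_n: "c \<bullet> n \<le> d"
    using norm_cauchy_schwarz[of c n] balls(1) unit_n by simp
  have "(1 - t) * (norm c)\<^sup>2 + t * (norm (c - u))\<^sup>2 \<le> (1 - t) * d\<^sup>2 + t * d\<^sup>2"
    using balls t by (intro add_mono mult_left_mono power_mono) auto
  then have norm_c: "(norm c)\<^sup>2 - 2 * t * (c \<bullet> u) \<le> d\<^sup>2 - t * (norm u)\<^sup>2"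
    by (simp add: power2_norm_eq_inner inner_diff inner_commute algebra_simps)
  have "(norm (c - t *\<^sub>R (u - \<sigma> *\<^sub>R n)))\<^sup>2
      = (norm c)\<^sup>2 - 2 * t * (c \<bullet> u) + t * (2 * (\<sigma> * (c \<bullet> n)) + t * (norm (u - \<sigma> *\<^sub>R n))\<^sup>2)"
    by (simp add: power2_norm_eq_inner inner_diff inner_commute algebra_simps)
  also have "\<dots> \<le> d\<^sup>2 - t * (norm u)\<^sup>2 + t * (2 * (\<sigma> * d) + ((norm u)\<^sup>2 - 2 * d * \<sigma>))"
    using norm_c inner_c_n t \<sigma> room by (intro add_mono mult_left_mono) auto
  also have "\<dots> = d\<^sup>2"
    by (simp add: algebra_simps)
  finally show ?thesis
    using order_trans[OF norm_ge_zero balls(1)] by (rule power2_le_imp_le)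
qed

lemma spindle_below_tip:
  fixes u n :: "'a::real_inner"
  assumes "0 \<le> d" and unit_n: "norm n = 1" and far: "d < norm (u - d *\<^sub>R n)"
  obtains z where "z \<bullet> n < 0" "\<And>c. norm c \<le> d \<Longrightarrow> norm (c - u) \<le> d \<Longrightarrow> norm (c - z) \<le> d"
proof (cases "u \<bullet> n < 0")
  case True
  then show thesis
    using that[of u] by blast
next
  case False
  have "d\<^sup>2 < (norm (u - d *\<^sub>R n))\<^sup>2"
    using far \<open>0 \<le> d\<close> by (simp add: power_strict_mono)
  also have "\<dots> = (norm u)\<^sup>2 - 2 * d * (u \<bullet> n) + d\<^sup>2"
    unfolding power2_norm_eq_inner using unit_n
    by (simp add: inner_diff inner_commute norm_eq_1 power2_eq_square)
  finally have gap: "0 < (norm u)\<^sup>2 - 2 * d * (u \<bullet> n)"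
    by simp
  define \<sigma> where "\<sigma> = u \<bullet> n + ((norm u)\<^sup>2 - 2 * d * (u \<bullet> n)) / (2 * d + 1)"
  define \<delta> where "\<delta> = (norm u)\<^sup>2 - 2 * d * \<sigma>"
  define w where "w = u - \<sigma> *\<^sub>R n"
  define t where "t = \<delta> / (\<delta> + (norm w)\<^sup>2)"
  have \<sigma>: "u \<bullet> n < \<sigma>"
    using gap \<open>0 \<le> d\<close> by (simp add: \<sigma>_def)
  have "\<delta> = ((norm u)\<^sup>2 - 2 * d * (u \<bullet> n)) / (2 * d + 1)"
    using \<open>0 \<le> d\<close> by (simp add: \<delta>_def \<sigma>_def field_simps)
  then have "0 < \<delta>"
    using gap \<open>0 \<le> d\<close> by simp
  then have t: "0 < t" "t \<le> 1" "t * (norm w)\<^sup>2 \<le> \<delta>"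
    by (auto simp: t_def add_pos_nonneg divide_simps mult_left_mono)
  show thesis
  proof
    show "(t *\<^sub>R w) \<bullet> n < 0"
      using t(1) \<sigma> unit_n by (simp add: w_def inner_diff_left norm_eq_1 mult_pos_neg)
    show "norm (c - t *\<^sub>R w) \<le> d" if "norm c \<le> d" "norm (c - u) \<le> d" for c
      using t \<sigma> False that unfolding w_def \<delta>_def by (intro spindle_mem unit_n) auto
  qed
qed

lemma diametrically_complete_subset_cball:
  fixes K :: "'a::real_inner set"
  assumes K: "diametrically_complete d K" and "norm n = 1"
    and p: "p \<in> K" and lowest: "\<And>x. x \<in> K \<Longrightarrow> p \<bullet> n \<le> x \<bullet> n"
  shows "K \<subseteq> cball (p + d *\<^sub>R n) d"
proof (rule ccontr)
  note diameter = diametrically_complete_dist_le[OF K]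
  assume "\<not> ?thesis"
  then obtain q where q: "q \<in> K" "d < norm ((q - p) - d *\<^sub>R n)"
    by (auto simp: subset_iff dist_commute dist_norm diff_diff_eq)
  have "0 \<le> d"
    using diameter[OF p p] by simp
  then obtain z where z: "z \<bullet> n < 0"
      "\<And>c. norm c \<le> d \<Longrightarrow> norm (c - (q - p)) \<le> d \<Longrightarrow> norm (c - z) \<le> d"
    using spindle_below_tip \<open>norm n = 1\<close> q(2) by metis
  have "dist x (p + z) \<le> d" if "x \<in> K" for x
  proof -
    have "norm (x - p) \<le> d" "norm ((x - p) - (q - p)) \<le> d"
      using diameter[OF that p] diameter[OF that q(1)] by (simp_all add: dist_norm)
    then show ?thesis
      using z(2)[of "x - p"] by (simp add: dist_norm algebra_simps)
  qed
  then have "p + z \<in> K"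
    by (rule diametrically_complete_memI[OF K])
  then have "p \<bullet> n \<le> (p + z) \<bullet> n"
    by (rule lowest)
  with z(1) show False
    by (simp add: inner_add_left)
qed

lemma diametrically_complete_imp_constant_width:
  fixes K :: "'a::euclidean_space set"
  assumes K: "diametrically_complete d K"
  shows "constant_width d K"
  unfolding constant_width_def
proof (intro conjI ballI allI impI)
  show "dist x y \<le> d" if "x \<in> K" "y \<in> K" for x y
    using diametrically_complete_dist_le[OF K that] .
next
  fix n :: 'a assume "norm n = 1"
  have "continuous_on K (\<lambda>x. x \<bullet> n)"
    by (intro continuous_intros)
  then obtain p where p: "p \<in> K" "\<And>x. x \<in> K \<Longrightarrow> p \<bullet> n \<le> x \<bullet> n"
    using continuous_attains_inf diametrically_complete_compact[OF K] diametrically_complete_nonempty[OF K]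
    by metis
  then have "K \<subseteq> cball (p + d *\<^sub>R n) d"
    using K \<open>norm n = 1\<close> by (intro diametrically_complete_subset_cball)
  then have "p + d *\<^sub>R n \<in> K"
    by (intro diametrically_complete_memI[OF K]) (auto simp: dist_commute)
  with p(1) show "\<exists>p\<in>K. p + d *\<^sub>R n \<in> K" ..
qed

lemma constant_width_extension:
  fixes A :: "'a::euclidean_space set"
  assumes "0 \<le> d" "\<And>x y. x \<in> A \<Longrightarrow> y \<in> A \<Longrightarrow> dist x y \<le> d"
  obtains K where "A \<subseteq> K" "constant_width d K"
  using diametrically_complete_extension[OF assms] diametrically_complete_imp_constant_width by metis

section \<open>Rigid motions and support functions\<close>

definition rigid_motion :: "('a::real_inner \<Rightarrow> 'a) \<Rightarrow> bool" where
  "rigid_motion f \<longleftrightarrow> (\<exists>R v. orthogonal_transformation R \<and> f = (\<lambda>x. R x + v))"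

lemma rigid_motion_orthogonal_transformation: "orthogonal_transformation R \<Longrightarrow> rigid_motion R"
  unfolding rigid_motion_def by (intro exI[of _ R] exI[of _ 0]) simp

lemma rigid_motion_compose:
  assumes "rigid_motion f" "rigid_motion g"
  shows "rigid_motion (f \<circ> g)"
proof -
  obtain R v S w where R: "orthogonal_transformation R" "f = (\<lambda>x. R x + v)"
    and S: "orthogonal_transformation S" "g = (\<lambda>x. S x + w)"
    using assms by (auto simp: rigid_motion_def)
  have "f \<circ> g = (\<lambda>x. (R \<circ> S) x + (R w + v))"
    using R by (simp add: S fun_eq_iff orthogonal_transformation_def linear_add)
  then show ?thesis
    using orthogonal_transformation_compose[OF R(1) S(1)] unfolding rigid_motion_def by blast
qed

lemma dist_rigid_motion:
  assumes "rigid_motion f"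
  shows "dist (f x) (f y) = dist x y"
  using assms
  by (auto simp: rigid_motion_def dist_norm orthogonal_transformation simp flip: linear_diff)

lemma plane_isometry_rigid_motion:
  assumes "rigid_motion f"
  shows "plane_isometry f"
proof -
  obtain R v where R: "orthogonal_transformation R" "f = (+) v \<circ> R"
    using assms by (auto simp: rigid_motion_def fun_eq_iff add.commute)
  have "bij f"
    unfolding R(2) using orthogonal_transformation_bij[OF R(1)] by (intro bij_comp bij_plus)
  then show ?thesis
    using dist_rigid_motion[OF assms] by (simp add: plane_isometry_def)
qed

lemma constant_width_rigid_motion:
  fixes K :: "'a::euclidean_space set"
  assumes "rigid_motion f" "constant_width d K"
  shows "constant_width d (f ` K)"
proof -
  obtain R v where R: "orthogonal_transformation R" "f = (\<lambda>x. R x + v)"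
    using assms by (auto simp: rigid_motion_def)
  then have "linear R" and norm_R: "norm (R x) = norm x" for x
    by (auto simp: orthogonal_transformation)
  have "\<exists>p\<in>f ` K. p + d *\<^sub>R n \<in> f ` K" if "norm n = 1" for n
  proof -
    obtain m where m: "n = R m"
      using orthogonal_transformation_surj[OF R(1)] by (metis surjD)
    then have "norm m = 1"
      using that norm_R by simp
    then obtain p where p: "p \<in> K" "p + d *\<^sub>R m \<in> K"
      using constant_width_chord[OF assms(2)] by blast
    have "f p + d *\<^sub>R n = f (p + d *\<^sub>R m)"
      using \<open>linear R\<close> by (simp add: R m linear_add linear_scale)
    with p show ?thesis by force
  qed
  then show ?thesis
    using assms(2) by (auto simp: constant_width_def dist_rigid_motion[OF assms(1)])
qed

definition support_function :: "'a::real_inner set \<Rightarrow> 'a \<Rightarrow> real" where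
  "support_function K n = (SUP x\<in>K. x \<bullet> n)"

lemma inner_le_support_function:
  assumes "bounded K" "x \<in> K"
  shows "x \<bullet> n \<le> support_function K n"
  unfolding support_function_def
proof (rule cSUP_upper[OF assms(2)])
  have "bounded ((\<lambda>x. x \<bullet> n) ` K)"
    using assms(1) bounded_linear_inner_left by (rule bounded_linear_image)
  then show "bdd_above ((\<lambda>x. x \<bullet> n) ` K)"
    by (rule bounded_imp_bdd_above)
qed

lemma continuous_on_support_function:
  assumes "bounded K" "K \<noteq> {}"
  shows "continuous_on UNIV (support_function K)"
proof -
  obtain B where "0 < B" and B: "\<And>x. x \<in> K \<Longrightarrow> norm x \<le> B"
    using assms(1) bounded_pos by blast
  have support_le: "support_function K n \<le> support_function K m + B * dist n m" for n m
    unfolding support_function_def[of K n]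
  proof (rule cSUP_least[OF assms(2)])
    fix x assume x: "x \<in> K"
    have "x \<bullet> n = x \<bullet> m + x \<bullet> (n - m)"
      by (simp add: inner_diff_right)
    also have "\<dots> \<le> support_function K m + norm x * norm (n - m)"
      using inner_le_support_function[OF assms(1) x] norm_cauchy_schwarz by (rule add_mono)
    also have "\<dots> \<le> support_function K m + B * dist n m"
      using B[OF x] by (simp add: dist_norm mult_right_mono)
    finally show "x \<bullet> n \<le> support_function K m + B * dist n m" .
  qed
  have "B-lipschitz_on UNIV (support_function K)"
  proof (rule lipschitz_onI)
    fix n m
    show "dist (support_function K n) (support_function K m) \<le> B * dist n m"
      using support_le[of n m] support_le[of m n] by (simp add: dist_real_def dist_commute abs_le_iff)
  qed (use \<open>0 < B\<close> in simp)
  then show ?thesis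
    by (rule lipschitz_on_continuous_on)
qed

lemma constant_width_bounded: "constant_width d K \<Longrightarrow> bounded K"
  using constant_width_dist_le unfolding bounded_two_points by blast

lemma constant_width_nonempty:
  fixes K :: "'a::euclidean_space set"
  shows "constant_width d K \<Longrightarrow> K \<noteq> {}"
  using norm_Basis[OF SOME_Basis] constant_width_chord by blast

lemma support_function_constant_width:
  assumes K: "constant_width d K" and unit_n: "norm n = 1"
  shows "support_function K n + support_function K (- n) = d"
proof -
  obtain p where p: "p \<in> K" "p + d *\<^sub>R n \<in> K"
    using constant_width_chord[OF assms] .
  have inner_n_n: "n \<bullet> n = 1"
    using unit_n by (simp add: norm_eq_1)
  have inner_diff_le: "(x - y) \<bullet> n \<le> d" if "x \<in> K" "y \<in> K" for x y
    using norm_cauchy_schwarz[of "x - y" n] constant_width_dist_le[OF K that] unit_n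
    by (simp add: dist_norm)
  have "support_function K n = p \<bullet> n + d"
    unfolding support_function_def
  proof (rule cSup_eq_maximum)
    show "p \<bullet> n + d \<in> (\<lambda>x. x \<bullet> n) ` K"
      using p(2) inner_n_n by (intro image_eqI[of _ _ "p + d *\<^sub>R n"]) (auto simp: inner_add_left)
  qed (use inner_diff_le p(1) in \<open>force simp: inner_diff_left\<close>)
  moreover have "support_function K (- n) = - (p \<bullet> n)"
    unfolding support_function_def
  proof (rule cSup_eq_maximum)
    show "- (p \<bullet> n) \<in> (\<lambda>x. x \<bullet> - n) ` K"
      using p(1) by force
  qed (use inner_diff_le[OF p(2)] inner_n_n in \<open>force simp: inner_diff_left inner_add_left\<close>)
  ultimately show ?thesis by simp
qed

lemma constant_width_slab:
  assumes K: "constant_width d K" and unit_n: "norm n = 1" and x: "x \<in> K"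
  shows "\<bar>x \<bullet> n - (support_function K n - d / 2)\<bar> \<le> d / 2"
  using inner_le_support_function[OF constant_width_bounded[OF K] x, of n]
    inner_le_support_function[OF constant_width_bounded[OF K] x, of "- n"]
    support_function_constant_width[OF K unit_n]
  unfolding abs_le_iff inner_minus_right by argo

lemma constant_width_contact:
  assumes K: "constant_width d K" and unit_n: "norm n = 1" and slab: "\<And>x. x \<in> K \<Longrightarrow> \<bar>x \<bullet> n\<bar> \<le> d / 2"
  obtains q where "q \<in> K" "q \<bullet> n = - d / 2"
proof -
  obtain p where p: "p \<in> K" "p + d *\<^sub>R n \<in> K"
    using constant_width_chord[OF K unit_n] .
  have "(p + d *\<^sub>R n) \<bullet> n = p \<bullet> n + d"
    using unit_n by (simp add: inner_add_left norm_eq_1)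
  with slab[OF p(1)] slab[OF p(2)] have "p \<bullet> n = - d / 2"
    unfolding abs_le_iff by argo
  with p(1) show thesis by (rule that)
qed

section \<open>Rotations and coordinates of the plane\<close>

definition perp :: "real^2 \<Rightarrow> real^2" where
  "perp x = vector [- x$2, x$1]"

lemma linear_perp: "linear perp"
  by (rule linearI) (auto simp: perp_def vec_eq_iff forall_2)

lemma perp_perp: "perp (perp x) = - x"
  by (simp add: perp_def vec_eq_iff forall_2)

lemma inner_perp_perp: "perp x \<bullet> perp y = x \<bullet> y"
  by (simp add: perp_def inner_vec_def sum_2)

lemma inner_perp_left: "perp x \<bullet> y = - (x \<bullet> perp y)"
  by (simp add: perp_def inner_vec_def sum_2)

definition rotation :: "real \<Rightarrow> real^2 \<Rightarrow> real^2" where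
  "rotation \<theta> x = cos \<theta> *\<^sub>R x + sin \<theta> *\<^sub>R perp x"

lemma rotation_zero: "rotation 0 x = x"
  by (simp add: rotation_def)

lemma rotation_add: "rotation (\<theta> + \<phi>) x = rotation \<theta> (rotation \<phi> x)"
  by (simp add: rotation_def cos_add sin_add linear_add[OF linear_perp] linear_scale[OF linear_perp]
      perp_perp algebra_simps)

lemma rotation_add_pi: "rotation (\<theta> + pi) x = - rotation \<theta> x"
  by (simp add: rotation_def)

lemma inner_rotation_left: "rotation \<theta> x \<bullet> y = x \<bullet> rotation (- \<theta>) y"
  by (simp add: rotation_def inner_add_left inner_diff_right inner_perp_left)

lemma orthogonal_transformation_rotation: "orthogonal_transformation (rotation \<theta>)"
  unfolding orthogonal_transformation_def
proof (intro conjI allI)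
  show "linear (rotation \<theta>)"
    unfolding rotation_def[abs_def]
    by (intro linear_compose_add linear_compose_scale_right linear_ident linear_perp)
  fix x y
  show "rotation \<theta> x \<bullet> rotation \<theta> y = x \<bullet> y"
    by (simp add: inner_rotation_left rotation_zero flip: rotation_add)
qed

lemma rigid_motion_rotation: "rigid_motion (rotation \<theta>)"
  by (rule rigid_motion_orthogonal_transformation[OF orthogonal_transformation_rotation])

lemma norm_rotation: "norm (rotation \<theta> x) = norm x"
  by (rule orthogonal_transformation_norm[OF orthogonal_transformation_rotation])

lemma continuous_on_rotation [continuous_intros]:
  fixes f :: "'a::t2_space \<Rightarrow> real"
  shows "continuous_on S f \<Longrightarrow> continuous_on S (\<lambda>\<theta>. rotation (f \<theta>) x)"
  unfolding rotation_def by (intro continuous_intros)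

text \<open>Scaling the ordinate makes all data of the construction rational.\<close>
definition pt :: "real \<Rightarrow> real \<Rightarrow> real^2" where
  "pt u v = vector [u, v / sqrt 3]"

lemma pt_exhaust:
  obtains u v where "x = pt u v"
proof
  show "x = pt (x$1) (sqrt 3 * x$2)"
    by (simp add: pt_def vec_eq_iff forall_2)
qed

lemma pt_add: "pt a b + pt c d = pt (a + c) (b + d)"
  and pt_diff: "pt a b - pt c d = pt (a - c) (b - d)"
  and pt_minus: "- pt a b = pt (- a) (- b)"
  and pt_scaleR: "r *\<^sub>R pt a b = pt (r * a) (r * b)"
  by (simp_all add: pt_def vec_eq_iff forall_2 add_divide_distrib diff_divide_distrib)

lemma inner_pt: "pt a b \<bullet> pt c d = a * c + b * d / 3"
  by (simp add: pt_def inner_vec_def sum_2)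

lemma norm_pt: "norm (pt a b) = sqrt (a\<^sup>2 + b\<^sup>2 / 3)"
  by (simp add: norm_eq_sqrt_inner inner_pt power2_eq_square)

lemma rotation_pi_third_pt: "rotation (pi / 3) (pt a b) = pt ((a - b) / 2) ((3 * a + b) / 2)"
  by (simp add: rotation_def perp_def pt_def vec_eq_iff forall_2 cos_60 sin_60 field_simps)

section \<open>The circumscribed regular hexagon\<close>

definition hexagon_normals :: "(real^2) set" where
  "hexagon_normals = {pt 1 0, pt (1/2) (3/2), pt (-1/2) (3/2)}"

lemma norm_hexagon_normal: "n \<in> hexagon_normals \<Longrightarrow> norm n = 1"
  by (auto simp: hexagon_normals_def norm_pt power2_eq_square)

definition regular_hexagon :: "(real^2) set" where
  "regular_hexagon = {x. \<forall>n\<in>hexagon_normals. \<bar>x \<bullet> n\<bar> \<le> 1/2}"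

lemma pt_in_regular_hexagon_iff:
  "pt u v \<in> regular_hexagon \<longleftrightarrow> \<bar>u\<bar> \<le> 1/2 \<and> \<bar>u + v\<bar> \<le> 1 \<and> \<bar>v - u\<bar> \<le> 1"
  by (simp add: regular_hexagon_def hexagon_normals_def inner_pt abs_le_iff) argo

lemma rotation_regular_hexagon:
  assumes "x \<in> regular_hexagon"
  shows "rotation (real k * pi / 3) x \<in> regular_hexagon"
proof (induction k)
  case 0
  then show ?case
    using assms by (simp add: rotation_zero)
next
  case (Suc k)
  obtain u v where uv: "rotation (real k * pi / 3) x = pt u v"
    by (rule pt_exhaust)
  have "rotation (pi / 3) (pt u v) \<in> regular_hexagon"
    using Suc.IH unfolding uv rotation_pi_third_pt pt_in_regular_hexagon_iff abs_le_iff by argo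
  then show ?case
    unfolding uv[symmetric] rotation_add[symmetric] by (simp add: algebra_simps add_divide_distrib)
qed

lemma constant_width_balanced_rotation:
  assumes K: "constant_width d K" and unit_n: "norm n = 1"
  defines "h \<equiv> \<lambda>\<theta>. support_function K (rotation \<theta> n)"
  obtains \<theta> where "h \<theta> + h (\<theta> + 2 * pi / 3) = h (\<theta> + pi / 3) + d / 2"
proof -
  define F where "F \<theta> = h \<theta> - h (\<theta> + pi / 3) + h (\<theta> + 2 * pi / 3) - d / 2" for \<theta>
  have "continuous_on UNIV (support_function K)"
    using K by (intro continuous_on_support_function constant_width_bounded constant_width_nonempty)
  then have "continuous_on UNIV h"
    unfolding h_def by (rule continuous_on_compose2) (auto intro!: continuous_intros)
  then have cont: "continuous_on {0..pi / 3} F"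
    unfolding F_def by (intro continuous_intros; elim continuous_on_compose2) (auto intro!: continuous_intros)
  have "h 0 + h pi = d"
    using support_function_constant_width[OF K, of "rotation 0 n"] unit_n rotation_add_pi[of 0 n]
    by (simp add: h_def norm_rotation)
  then have "F (pi / 3) = - F 0"
    by (simp add: F_def)
  then obtain \<theta> where "F \<theta> = 0"
    using IVT'[of F 0 0 "pi / 3"] IVT2'[of F "pi / 3" 0 0] cont by (cases "F 0 \<le> 0") force+
  then show thesis
    by (intro that[of \<theta>]) (simp add: F_def)
qed

lemma circumscribed_regular_hexagon:
  assumes K: "constant_width 1 K"
  obtains f where "rigid_motion f" "f ` K \<subseteq> regular_hexagon"
proof -
  have unit: "norm (pt 1 0) = 1"
    by (simp add: norm_pt)
  obtain \<theta> where balanced: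
      "support_function K (rotation \<theta> (pt 1 0)) + support_function K (rotation (\<theta> + 2 * pi / 3) (pt 1 0))
        = support_function K (rotation (\<theta> + pi / 3) (pt 1 0)) + 1/2"
    using constant_width_balanced_rotation[OF K unit] by blast
  define c where "c n = support_function K (rotation \<theta> n) - 1/2" for n
  have "rotation (pi / 3) (pt 1 0) = pt (1/2) (3/2)" "rotation (2 * pi / 3) (pt 1 0) = pt (-1/2) (3/2)"
    using rotation_add[of "pi / 3" "pi / 3" "pt 1 0"] by (simp_all add: rotation_pi_third_pt)
  with balanced have c_balanced: "c (pt (-1/2) (3/2)) = c (pt (1/2) (3/2)) - c (pt 1 0)"
    by (simp add: c_def rotation_add)
  \<comment> \<open>balance makes the centre lines of the three strips meet in one point\<close>
  define z where "z = pt (c (pt 1 0)) (2 * c (pt (1/2) (3/2)) - c (pt 1 0))"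
  have z: "z \<bullet> n = c n" if "n \<in> hexagon_normals" for n
    using that c_balanced by (auto simp: hexagon_normals_def z_def inner_pt field_simps)
  have "rotation (- \<theta>) x - z \<in> regular_hexagon" if x: "x \<in> K" for x
    unfolding regular_hexagon_def
  proof (intro CollectI ballI)
    fix n assume n: "n \<in> hexagon_normals"
    then have "norm (rotation \<theta> n) = 1"
      by (simp add: norm_rotation norm_hexagon_normal)
    then show "\<bar>(rotation (- \<theta>) x - z) \<bullet> n\<bar> \<le> 1/2"
      using constant_width_slab[OF K _ x] z[OF n] by (simp add: inner_diff_left inner_rotation_left c_def)
  qed
  then have "(\<lambda>x. rotation (- \<theta>) x + - z) ` K \<subseteq> regular_hexagon"
    by auto
  moreover have "rigid_motion (\<lambda>x. rotation (- \<theta>) x + - z)"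
    using orthogonal_transformation_rotation unfolding rigid_motion_def by blast
  ultimately show thesis
    by (rule that[rotated])
qed

section \<open>Placement in the hexagon\<close>

definition avoids :: "'a::real_inner set \<Rightarrow> 'a \<Rightarrow> bool" where
  "avoids K n \<longleftrightarrow> (\<forall>x\<in>K. x \<bullet> n \<le> 1/2)"

lemma avoids_rotation: "avoids (rotation \<theta> ` K) n \<longleftrightarrow> avoids K (rotation (- \<theta>) n)"
  by (simp add: avoids_def inner_rotation_left)

lemma avoids_or_opposite:
  assumes diameter: "\<And>x y. x \<in> K \<Longrightarrow> y \<in> K \<Longrightarrow> dist x y \<le> 1" and unit_n: "norm n = 1"
  shows "avoids K n \<or> avoids K (- n)"
proof (rule ccontr)
  assume "\<not> ?thesis"
  then obtain x y where xy: "x \<in> K" "y \<in> K" "1/2 < x \<bullet> n" "1/2 < - (y \<bullet> n)"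
    by (auto simp: avoids_def not_le)
  have "(x - y) \<bullet> n \<le> norm (x - y) * norm n"
    by (rule norm_cauchy_schwarz)
  also have "\<dots> \<le> 1"
    using diameter[OF xy(1,2)] unit_n by (simp add: dist_norm)
  finally show False
    using xy(3,4) by (simp add: inner_diff_left)
qed

lemma periodic_choice_two_apart:
  fixes P :: "nat \<Rightarrow> bool"
  assumes opposite: "\<And>k. P k \<or> P (k + 3)" and period: "\<And>k. P (k + 6) = P k"
  obtains k where "P k" "P (k + 2)"
proof (rule ccontr)
  assume "\<not> thesis"
  with that have none: "\<not> P (k + 2)" if "P k" for k
    using \<open>P k\<close> by blast
  have "\<not> P k" for k
  proof
    assume "P k"
    then have "P (k + 5)"
      using none[of k] opposite[of "k + 2"] by (simp add: add.commute)
    then have "P (k + 4)"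
      using none[of "k + 5"] period[of "k + 1"] opposite[of "k + 1"] by (simp add: add.commute)
    then show False
      using none[of "k + 4"] period[of k] \<open>P k\<close> by (simp add: add.commute)
  qed
  then show False
    using opposite by blast
qed

lemma avoids_two_apart:
  assumes diameter: "\<And>x y. x \<in> K \<Longrightarrow> y \<in> K \<Longrightarrow> dist x y \<le> 1" and unit_n: "norm n = 1"
  obtains k where "avoids (rotation (real k * pi / 3) ` K) n"
    "avoids (rotation (real k * pi / 3) ` K) (rotation (- (2 * pi / 3)) n)"
proof -
  define P where "P k = avoids K (rotation (- (real k * pi / 3)) n)" for k
  have opposite: "rotation (- (real (k + 3) * pi / 3)) n = - rotation (- (real k * pi / 3)) n" for k
    using rotation_add_pi[of "- (real (k + 3) * pi / 3)" n] by (simp add: algebra_simps add_divide_distrib)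
  have "P k \<or> P (k + 3)" for k
    unfolding P_def opposite using avoids_or_opposite[OF diameter] unit_n by (simp add: norm_rotation)
  moreover have "P (k + 6) = P k" for k
    using opposite[of "k + 3"] opposite[of k] by (simp add: P_def add.assoc)
  ultimately obtain k where "P k" "P (k + 2)"
    using periodic_choice_two_apart[of P] by blast
  then show thesis
    by (intro that[of k]) (simp_all add: P_def avoids_rotation algebra_simps add_divide_distrib flip: rotation_add)
qed

definition reflect :: "real^2 \<Rightarrow> real^2" where
  "reflect x = vector [x$1, - x$2]"

lemma reflect_pt: "reflect (pt u v) = pt u (- v)"
  by (simp add: reflect_def pt_def)

lemma inner_reflect_left: "reflect x \<bullet> y = x \<bullet> reflect y"
  by (simp add: reflect_def inner_vec_def sum_2)

lemma orthogonal_transformation_reflect: "orthogonal_transformation reflect"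
  unfolding orthogonal_transformation_def
proof (intro conjI allI)
  show "linear reflect"
    by (rule linearI) (simp_all add: reflect_def vec_eq_iff forall_2)
qed (simp add: reflect_def inner_vec_def sum_2)

lemma rigid_motion_reflect: "rigid_motion reflect"
  by (rule rigid_motion_orthogonal_transformation[OF orthogonal_transformation_reflect])

lemma avoids_reflect: "avoids (reflect ` K) n \<longleftrightarrow> avoids K (reflect n)"
  by (simp add: avoids_def inner_reflect_left)

definition inscribed :: "(real^2) set \<Rightarrow> bool" where
  "inscribed K \<longleftrightarrow> constant_width 1 K \<and> K \<subseteq> regular_hexagon"

lemma inscribed_rotation: "inscribed K \<Longrightarrow> inscribed (rotation (real k * pi / 3) ` K)"
  unfolding inscribed_def
  using rotation_regular_hexagon constant_width_rigid_motion[OF rigid_motion_rotation] by blast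

lemma reflect_regular_hexagon:
  assumes "x \<in> regular_hexagon"
  shows "reflect x \<in> regular_hexagon"
  using assms by (cases x rule: pt_exhaust) (simp add: reflect_pt pt_in_regular_hexagon_iff abs_le_iff)

lemma inscribed_reflect: "inscribed K \<Longrightarrow> inscribed (reflect ` K)"
  unfolding inscribed_def
  using reflect_regular_hexagon constant_width_rigid_motion[OF rigid_motion_reflect] by blast

lemma inscribed_contact:
  assumes "inscribed K" "n \<in> hexagon_normals"
  obtains q where "q \<in> K" "q \<bullet> n = - 1 / 2"
proof (rule constant_width_contact)
  show "constant_width 1 K" "norm n = 1"
    using assms by (simp_all add: inscribed_def norm_hexagon_normal)
  show "\<bar>x \<bullet> n\<bar> \<le> 1 / 2" if "x \<in> K" for x
    using assms that by (auto simp: inscribed_def regular_hexagon_def)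
qed

lemma inscribed_contact_CD:
  assumes "inscribed K"
  obtains v where "pt (-1/2) v \<in> K"
proof -
  obtain q where q: "q \<in> K" "q \<bullet> pt 1 0 = - 1 / 2"
    by (rule inscribed_contact[OF assms, of "pt 1 0"]) (simp_all add: hexagon_normals_def)
  with that show thesis
    by (cases q rule: pt_exhaust) (simp add: inner_pt)
qed

lemma inscribed_contact_DE:
  assumes "inscribed K"
  obtains u where "pt u (- 1 - u) \<in> K"
proof -
  obtain q where q: "q \<in> K" "q \<bullet> pt (1/2) (3/2) = - 1 / 2"
    by (rule inscribed_contact[OF assms, of "pt (1/2) (3/2)"]) (simp_all add: hexagon_normals_def)
  obtain u v where uv: "q = pt u v"
    by (rule pt_exhaust)
  with q(2) have "v = - 1 - u"
    by (simp add: inner_pt)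
  with q(1) that show thesis
    by (simp add: uv)
qed

text \<open>
  The unit normals of the lines of \<open>C+\<close> and \<open>E+\<close>, where \<open>A, \<dots>, F\<close> lie in the directions of
  30, 90, \<open>\<dots>\<close>, 330 degrees. The slant is chosen such that both are rational:
  \<open>1177\<^sup>2 + 1131\<^sup>2 / 3 = 23\<^sup>2 + 2331\<^sup>2 / 3 = 1346\<^sup>2\<close>. Reflection takes \<open>C+\<close> to \<open>D-\<close> and \<open>E+\<close> to \<open>B-\<close>,
  so the negated reflections are the normals of \<open>A-\<close> and \<open>E-\<close>.
\<close>
definition cut_normal_C :: "real^2" where
  "cut_normal_C = pt (-1177/1346) (1131/1346)"

definition cut_normal_E :: "real^2" where
  "cut_normal_E = pt (23/1346) (-2331/1346)"

lemma norm_cut_normal_E: "norm cut_normal_E = 1"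
  and norm_cut_normal_C: "norm cut_normal_C = 1"
  by (simp_all add: cut_normal_C_def cut_normal_E_def norm_pt power2_eq_square)

lemma rotation_cut_normal_E: "rotation (- (2 * pi / 3)) cut_normal_E = cut_normal_C"
proof -
  have "cut_normal_E = rotation (pi / 3) (rotation (pi / 3) cut_normal_C)"
    by (simp add: cut_normal_C_def cut_normal_E_def rotation_pi_third_pt)
  also have "\<dots> = rotation (2 * pi / 3) cut_normal_C"
    by (simp flip: rotation_add)
  finally have "rotation (- (2 * pi / 3)) cut_normal_E = rotation (- (2 * pi / 3) + 2 * pi / 3) cut_normal_C"
    by (simp only: rotation_add)
  then show ?thesis
    by (simp add: rotation_zero)
qed

definition placed :: "(real^2) set \<Rightarrow> bool" where
  "placed K \<longleftrightarrow> inscribed K \<and> avoids K cut_normal_C \<and> avoids K cut_normal_E \<and>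
     (avoids K (- reflect cut_normal_C) \<or> avoids K (- reflect cut_normal_E) \<or> (\<exists>v\<le>0. pt (-1/2) v \<in> K))"

lemma placed_or_placed_reflect:
  assumes K: "inscribed K" "avoids K cut_normal_C" "avoids K cut_normal_E"
  shows "placed K \<or> placed (reflect ` K)"
proof (cases "avoids K (- reflect cut_normal_C) \<or> avoids K (- reflect cut_normal_E)")
  case True
  then show ?thesis
    using K by (auto simp: placed_def)
next
  case False
  have "avoids K (reflect n) \<or> avoids K (- reflect n)" if "norm n = 1" for n
    using K(1) that orthogonal_transformation_norm[OF orthogonal_transformation_reflect]
    by (intro avoids_or_opposite) (auto simp: inscribed_def constant_width_def)
  then have reflected: "avoids (reflect ` K) cut_normal_C" "avoids (reflect ` K) cut_normal_E"
    using False norm_cut_normal_C norm_cut_normal_E by (auto simp: avoids_reflect)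
  obtain v where v: "pt (-1/2) v \<in> K"
    using inscribed_contact_CD[OF K(1)] .
  then have v': "pt (-1/2) (- v) \<in> reflect ` K"
    by (metis imageI reflect_pt)
  show ?thesis
  proof (cases "v \<le> 0")
    case True
    then have "placed K"
      using K v unfolding placed_def by blast
    then show ?thesis ..
  next
    case False
    then have "\<exists>w\<le>0. pt (-1/2) w \<in> reflect ` K"
      using v' by (intro exI[of _ "- v"]) simp
    then have "placed (reflect ` K)"
      using reflected inscribed_reflect[OF K(1)] unfolding placed_def by blast
    then show ?thesis ..
  qed
qed

lemma inscribed_placement:
  assumes K: "inscribed K"
  obtains f where "rigid_motion f" "placed (f ` K)"
proof -
  have "dist x y \<le> 1" if "x \<in> K" "y \<in> K" for x y
    using K that by (auto simp: inscribed_def constant_width_def)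
  then obtain k where "avoids (rotation (real k * pi / 3) ` K) cut_normal_E"
      "avoids (rotation (real k * pi / 3) ` K) cut_normal_C"
    using avoids_two_apart[OF _ norm_cut_normal_E, of K] unfolding rotation_cut_normal_E by blast
  moreover define g where "g = rotation (real k * pi / 3)"
  ultimately have "placed (g ` K) \<or> placed (reflect ` g ` K)"
    using inscribed_rotation[OF K] by (intro placed_or_placed_reflect) auto
  moreover have "rigid_motion g" "rigid_motion (reflect \<circ> g)"
    unfolding g_def by (intro rigid_motion_compose rigid_motion_rotation rigid_motion_reflect)+
  ultimately show thesis
    using that[of g] that[of "reflect \<circ> g"] by (auto simp: image_comp)
qed

section \<open>Convex polygons\<close>

definition cross2 :: "real^2 \<Rightarrow> real^2 \<Rightarrow> real" where
  "cross2 x y = x$1 * y$2 - x$2 * y$1"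

lemma cross2_eq_inner_perp: "cross2 x y = perp x \<bullet> y"
  by (simp add: cross2_def perp_def inner_vec_def sum_2)

lemma cross2_le_norm: "cross2 x y \<le> norm x * norm y"
  using norm_cauchy_schwarz[of "perp x" y] inner_perp_perp[of x x]
  by (simp add: cross2_eq_inner_perp norm_eq_sqrt_inner)

lemma cross2_pt: "cross2 (pt a b) (pt c d) = (a * d - b * c) / sqrt 3"
  by (simp add: cross2_def pt_def diff_divide_distrib)

definition left_of :: "real^2 \<Rightarrow> real^2 \<Rightarrow> (real^2) set" where
  "left_of p q = {x. 0 \<le> cross2 (q - p) (x - p)}"

lemma left_of_eq_halfspace: "left_of p q = {x. perp (q - p) \<bullet> p \<le> perp (q - p) \<bullet> x}"
  by (simp add: left_of_def cross2_eq_inner_perp inner_diff_right)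

lemma left_of_combination:
  assumes "0 \<le> c" "q - p = (q - p') + c *\<^sub>R (q' - q)"
  shows "left_of p' q \<inter> left_of q q' \<subseteq> left_of p q"
proof
  fix x assume x: "x \<in> left_of p' q \<inter> left_of q q'"
  have p: "p = p' - c *\<^sub>R (q' - q)"
    using assms(2) by (simp add: algebra_simps)
  have "cross2 (q - p) (x - p) = cross2 (q - p') (x - p') + c * cross2 (q' - q) (x - q)"
    unfolding p by (simp add: cross2_def algebra_simps)
  then show "x \<in> left_of p q"
    using x \<open>0 \<le> c\<close> by (simp add: left_of_def)
qed

text \<open>The vertices are listed counterclockwise, and the first one is repeated at the end.\<close>
definition polygon :: "(real^2) list \<Rightarrow> (real^2) set" where
  "polygon vs = {x. successively (\<lambda>p q. x \<in> left_of p q) vs}"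

lemma polygon_Cons_Cons: "polygon (p # q # vs) = left_of p q \<inter> polygon (q # vs)"
  by (auto simp: polygon_def)

lemma polygon_append:
  "xs \<noteq> [] \<Longrightarrow> ys \<noteq> [] \<Longrightarrow> polygon (xs @ ys) = polygon xs \<inter> left_of (last xs) (hd ys) \<inter> polygon ys"
  by (auto simp: polygon_def successively_append_iff)

lemma convex_polygon: "convex (polygon vs)"
proof (induction vs rule: induct_list012)
  case (3 p q vs)
  then show ?case
    by (simp add: polygon_Cons_Cons left_of_eq_halfspace convex_Int convex_halfspace_ge)
qed (simp_all add: polygon_def)

lemma closed_polygon: "closed (polygon vs)"
proof (induction vs rule: induct_list012)
  case (3 p q vs)
  then show ?case
    by (simp add: polygon_Cons_Cons left_of_eq_halfspace closed_Int closed_halfspace_ge)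
qed (simp_all add: polygon_def)

abbreviation edges :: "'a list \<Rightarrow> ('a \<times> 'a) list" where
  "edges vs \<equiv> zip vs (tl vs)"

lemma successively_conv_edges: "successively P vs \<longleftrightarrow> (\<forall>(p, q)\<in>set (edges vs). P p q)"
  by (induction vs rule: induct_list012) auto

lemma cross2_mult_inner: "cross2 p q * (x \<bullet> x) = (q \<bullet> x) * cross2 p x - (p \<bullet> x) * cross2 q x"
  by (simp add: cross2_def inner_vec_def sum_2 algebra_simps)

lemma closed_fan_sector:
  assumes turning: "successively (\<lambda>p q. 0 < cross2 p q) (a # ws @ [a])"
  obtains p q where "(p, q) \<in> set (edges (a # ws @ [a]))" "0 \<le> cross2 p x" "cross2 q x \<le> 0"
proof (rule ccontr)
  let ?vs = "a # ws @ [a]"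
  \<comment> \<open>otherwise all \<open>cross2 p x\<close> have the same sign, and the slopes increase strictly around the closed list\<close>
  assume "\<not> thesis"
  with that have "successively (\<lambda>p q. 0 \<le> cross2 p x \<longrightarrow> 0 < cross2 q x) ?vs"
    unfolding successively_conv_edges by force
  then have "sorted_wrt (\<lambda>p q. 0 \<le> cross2 p x \<longrightarrow> 0 < cross2 q x) ?vs"
    by (subst (asm) successively_conv_sorted_wrt) (auto intro!: transpI)
  then have same_sign: "0 < cross2 p x * cross2 q x" if "p \<in> set ?vs" "q \<in> set ?vs" for p q
    using that by (cases "0 < cross2 a x") (auto simp: sorted_wrt_append zero_less_mult_iff)
  have "x \<noteq> 0"
    using same_sign[of a a] by (auto simp: cross2_def)
  have slope: "(p \<bullet> x) / cross2 p x < (q \<bullet> x) / cross2 q x"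
    if "p \<in> set ?vs" "q \<in> set ?vs" "0 < cross2 p q" for p q
  proof -
    have "0 < cross2 p q * (x \<bullet> x) / (cross2 p x * cross2 q x)"
      using that same_sign \<open>x \<noteq> 0\<close> by simp
    also have "\<dots> = (q \<bullet> x) / cross2 q x - (p \<bullet> x) / cross2 p x"
      unfolding cross2_mult_inner using same_sign[OF that(1,2)]
      by (auto simp: divide_simps zero_less_mult_iff)
    finally show ?thesis by simp
  qed
  have "successively (\<lambda>p q. (p \<bullet> x) / cross2 p x < (q \<bullet> x) / cross2 q x) ?vs"
    using turning slope by (rule successively_mono)
  then have "sorted_wrt (\<lambda>p q. (p \<bullet> x) / cross2 p x < (q \<bullet> x) / cross2 q x) ?vs"
    by (subst (asm) successively_conv_sorted_wrt) (auto intro: transpI)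
  then show False by simp
qed

definition fan_triangle :: "(real^2) \<times> (real^2) \<Rightarrow> (real^2) set" where
  "fan_triangle = (\<lambda>(p, q). convex hull {0, p, q})"

lemma fan_triangleI:
  assumes pq: "0 < cross2 p q" and x: "0 \<le> cross2 p x" "cross2 q x \<le> 0" "x \<in> left_of p q"
  shows "x \<in> fan_triangle (p, q)"
proof -
  define r where "r = - cross2 q x / cross2 p q"
  define s where "s = cross2 p x / cross2 p q"
  have "0 \<le> r" "0 \<le> s"
    using pq x by (simp_all add: r_def s_def divide_nonpos_pos)
  moreover have "r + s \<le> 1"
  proof -
    have "- cross2 q x + cross2 p x \<le> cross2 p q"
      using x(3) by (simp add: left_of_def cross2_def algebra_simps)
    then show ?thesis
      using pq by (simp add: r_def s_def flip: add_divide_distrib diff_divide_distrib)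
  qed
  moreover have "x = r *\<^sub>R p + s *\<^sub>R q"
  proof -
    have "cross2 p q *\<^sub>R x = (- cross2 q x) *\<^sub>R p + cross2 p x *\<^sub>R q"
      by (simp add: vec_eq_iff forall_2 cross2_def algebra_simps)
    then have "x = (1 / cross2 p q) *\<^sub>R ((- cross2 q x) *\<^sub>R p + cross2 p x *\<^sub>R q)"
      using pq by (metis less_irrefl scaleR_one scaleR_scaleR nonzero_eq_divide_eq)
    then show ?thesis
      by (simp add: r_def s_def scaleR_right_distrib scaleR_right_diff_distrib)
  qed
  ultimately show ?thesis
    unfolding fan_triangle_def prod.case convex_hull_3
    by (intro CollectI exI[of _ "1 - r - s"] exI[of _ r] exI[of _ s]) auto
qed

lemma polygon_subset_fan_triangles:
  assumes closed: "vs = a # ws @ [a]" and turning: "successively (\<lambda>p q. 0 < cross2 p q) vs"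
  shows "polygon vs \<subseteq> (\<Union>e\<in>set (edges vs). fan_triangle e)"
proof
  fix x assume "x \<in> polygon vs"
  then have left: "x \<in> left_of p q" if "(p, q) \<in> set (edges vs)" for p q
    using that by (auto simp: polygon_def successively_conv_edges)
  obtain p q where pq: "(p, q) \<in> set (edges vs)" "0 \<le> cross2 p x" "cross2 q x \<le> 0"
    using closed_fan_sector turning unfolding closed by metis
  moreover have "0 < cross2 p q"
    using turning pq(1) by (auto simp: successively_conv_edges)
  ultimately have "x \<in> fan_triangle (p, q)"
    using left by (intro fan_triangleI)
  with pq(1) show "x \<in> (\<Union>e\<in>set (edges vs). fan_triangle e)" by blast
qed

lemma fan_triangle_lmeasurable: "fan_triangle e \<in> lmeasurable"
  unfolding fan_triangle_def case_prod_beta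
  by (intro lmeasurable_compact finite_imp_compact_convex_hull) simp

lemma emeasure_fan_triangle: "emeasure lebesgue (fan_triangle (p, q)) = ennreal (\<bar>cross2 p q\<bar> / 2)"
proof -
  have "measure lebesgue (fan_triangle (p, q)) = measure lborel (fan_triangle (p, q))"
    by (intro measure_completion) (simp add: fan_triangle_def borel_compact finite_imp_compact_convex_hull)
  also have "\<dots> = \<bar>cross2 p q\<bar> / 2"
    unfolding fan_triangle_def prod.case content_triangle
    by (simp add: cross2_def abs_minus_commute mult.commute)
  finally show ?thesis
    using emeasure_eq_measure2[OF fan_triangle_lmeasurable] by simp
qed

lemma sum_set_le_sum_list:
  fixes g :: "'a \<Rightarrow> 'b::ordered_comm_monoid_add"
  assumes "\<And>x. x \<in> set xs \<Longrightarrow> 0 \<le> g x"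
  shows "(\<Sum>x\<in>set xs. g x) \<le> (\<Sum>x\<leftarrow>xs. g x)"
  using assms
proof (induction xs)
  case (Cons x xs)
  then show ?case
    by (cases "x \<in> set xs") (auto simp: insert_absorb intro: add_increasing add_left_mono)
qed simp

lemma emeasure_polygon_le:
  assumes closed: "vs = a # ws @ [a]" and turning: "successively (\<lambda>p q. 0 < cross2 p q) vs"
  shows "emeasure lebesgue (polygon vs) \<le> ennreal ((\<Sum>(p, q)\<leftarrow>edges vs. cross2 p q) / 2)"
proof -
  have pos: "0 < cross2 p q" if "(p, q) \<in> set (edges vs)" for p q
    using turning that by (auto simp: successively_conv_edges)
  have "emeasure lebesgue (polygon vs) \<le> emeasure lebesgue (\<Union>e\<in>set (edges vs). fan_triangle e)"
    using polygon_subset_fan_triangles[OF assms] fan_triangle_lmeasurable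
    by (intro emeasure_mono sets.finite_UN) auto
  also have "\<dots> \<le> (\<Sum>e\<in>set (edges vs). emeasure lebesgue (fan_triangle e))"
    using fan_triangle_lmeasurable by (intro emeasure_subadditive_finite) auto
  also have "\<dots> = (\<Sum>(p, q)\<in>set (edges vs). ennreal (cross2 p q / 2))"
    using pos by (intro sum.cong) (auto simp: emeasure_fan_triangle less_imp_le)
  also have "\<dots> = ennreal (\<Sum>(p, q)\<in>set (edges vs). cross2 p q / 2)"
    unfolding case_prod_beta using pos by (intro sum_ennreal) (auto simp: less_imp_le)
  also have "\<dots> \<le> ennreal (\<Sum>(p, q)\<leftarrow>edges vs. cross2 p q / 2)"
    using pos by (intro ennreal_leI sum_set_le_sum_list) (auto simp: less_imp_le)
  also have "(\<Sum>(p, q)\<leftarrow>edges vs. cross2 p q / 2) = (\<Sum>(p, q)\<leftarrow>edges vs. cross2 p q) / 2"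
    unfolding divide_inverse case_prod_beta sum_list_mult_const ..
  finally show ?thesis .
qed

section \<open>The polygonal cover\<close>

text \<open>The edge stays left of the unit discs about all points \<open>r + t *\<^sub>R w\<close> with \<open>t \<ge> 0\<close>.\<close>
definition clears_unit_discs :: "real^2 \<Rightarrow> real^2 \<Rightarrow> real^2 \<Rightarrow> real^2 \<Rightarrow> bool" where
  "clears_unit_discs r w p q \<longleftrightarrow> 0 \<le> cross2 (q - p) w \<and> norm (q - p) \<le> cross2 (q - p) (r - p)"

lemma cball_subset_left_of:
  assumes "clears_unit_discs r w p q" "0 \<le> t"
  shows "cball (r + t *\<^sub>R w) 1 \<subseteq> left_of p q"
proof
  fix x assume "x \<in> cball (r + t *\<^sub>R w) 1"
  then have "cross2 (q - p) (r + t *\<^sub>R w - x) \<le> norm (q - p)"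
    using cross2_le_norm[of "q - p" "r + t *\<^sub>R w - x"] mult_left_le[of "norm (r + t *\<^sub>R w - x)" "norm (q - p)"]
    by (simp add: dist_norm)
  also have "\<dots> \<le> cross2 (q - p) (r - p) + t * cross2 (q - p) w"
    using assms by (intro add_increasing2) (simp_all add: clears_unit_discs_def)
  finally show "x \<in> left_of p q"
    by (simp add: left_of_def cross2_eq_inner_perp inner_diff_right inner_add_right)
qed

lemma cball_subset_polygon:
  assumes "successively (clears_unit_discs r w) vs" "0 \<le> t"
  shows "cball (r + t *\<^sub>R w) 1 \<subseteq> polygon vs"
proof
  fix x assume "x \<in> cball (r + t *\<^sub>R w) 1"
  then have "x \<in> left_of p q" if "clears_unit_discs r w p q" for p q
    using cball_subset_left_of[OF that \<open>0 \<le> t\<close>] by blast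
  with assms(1) show "x \<in> polygon vs"
    unfolding polygon_def mem_Collect_eq by (rule successively_mono)
qed

lemma clears_unit_discs_pt:
  "clears_unit_discs (pt a b) (pt c d) (pt p1 p2) (pt q1 q2) \<longleftrightarrow>
     (let e1 = q1 - p1; e2 = q2 - p2; m = e1 * (b - p2) - e2 * (a - p1)
      in 0 \<le> e1 * d - e2 * c \<and> 0 \<le> m \<and> 3 * e1\<^sup>2 + e2\<^sup>2 \<le> m\<^sup>2)"
proof -
  have "x * x + y * y / 3 \<le> m\<^sup>2 / 3 \<longleftrightarrow> 3 * x\<^sup>2 + y\<^sup>2 \<le> m\<^sup>2" for x y m :: real
    unfolding power2_eq_square by argo
  then show ?thesis
    by (simp add: clears_unit_discs_def pt_diff cross2_pt norm_le_square inner_pt power_divide zero_le_divide_iff Let_def)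
qed

lemma left_of_pt:
  "pt u v \<in> left_of (pt p1 p2) (pt q1 q2) \<longleftrightarrow> 0 \<le> (q1 - p1) * (v - p2) - (q2 - p2) * (u - p1)"
  by (simp add: left_of_def pt_diff cross2_pt zero_le_divide_iff)

lemma inscribed_subset_polygon:
  assumes K: "inscribed K" and "successively (clears_unit_discs r w) vs" "0 \<le> t" "r + t *\<^sub>R w \<in> K"
  shows "K \<subseteq> polygon vs"
proof -
  have "K \<subseteq> cball (r + t *\<^sub>R w) 1"
    using K assms(4) by (auto simp: inscribed_def constant_width_def)
  also have "\<dots> \<subseteq> polygon vs"
    using assms(2,3) by (rule cball_subset_polygon)
  finally show ?thesis .
qed

lemma inscribed_clears_CD:
  assumes "inscribed K" "pt (-1/2) v \<in> K" "v \<le> b" "successively (clears_unit_discs (pt (-1/2) b) (pt 0 (-1))) vs"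
  shows "K \<subseteq> polygon vs"
  using inscribed_subset_polygon[OF assms(1,4), of "b - v"] assms(2,3) by (simp add: pt_scaleR pt_add)

lemma inscribed_clears_DE:
  assumes "inscribed K" "pt u (- 1 - u) \<in> K" "u \<le> a"
    "successively (clears_unit_discs (pt a (- 1 - a)) (pt (-1) 1)) vs"
  shows "K \<subseteq> polygon vs"
  using inscribed_subset_polygon[OF assms(1,4), of "a - u"] assms(2,3) by (simp add: pt_scaleR pt_add)

text \<open>
  \<open>flat_part\<close> follows the sides of the hexagon, cut off at \<open>C\<close> and \<open>E\<close> along the lines of \<open>C+\<close> and \<open>E+\<close>.
  \<open>arc_FA\<close> approximates from outside the unit circle about the point of \<open>CD\<close> on the line of \<open>C+\<close>, and
  \<open>arc_AB\<close> the one about the point of \<open>DE\<close> on the line of \<open>E+\<close>. The edge between them is tangent to the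
  circle about the point of \<open>DE\<close> on the line of \<open>E-\<close> and passes just outside the intersection of the circle
  of \<open>arc_AB\<close> with the unit circle about the midpoint of \<open>CD\<close>.
\<close>
definition flat_part :: "(real^2) list" where
  "flat_part =
    [pt 0 1, pt (-37/100) (63/100), pt (-1/2) (13/58), pt (-1/2) (-1/2), pt (-13/100) (-87/100),
     pt (4/29) (-25/29), pt (1/2) (-1/2)]"

definition arc_FA :: "(real^2) list" where
  "arc_FA =
    [pt 0.500000 0.233307, pt 0.499891 0.251344, pt 0.499672 0.269478, pt 0.499343 0.287608,
     pt 0.498904 0.305730, pt 0.498356 0.323843, pt 0.497699 0.341946, pt 0.496932 0.360035,
     pt 0.496055 0.378110, pt 0.495070 0.396167, pt 0.493975 0.414206, pt 0.492772 0.432224,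
     pt 0.491459 0.450219, pt 0.490038 0.468190, pt 0.488322 0.488313]"

definition arc_AB :: "(real^2) list" where
  "arc_AB =
    [pt 0.450136 0.540791, pt 0.444480 0.547754, pt 0.434797 0.559378, pt 0.425036 0.570803,
     pt 0.415198 0.582028, pt 0.405284 0.593052, pt 0.395295 0.603873, pt 0.385234 0.614489,
     pt 0.375145 0.624855]"

definition cover_vertices :: "(real^2) list" where
  "cover_vertices = flat_part @ arc_FA @ arc_AB @ [pt 0 1]"

lemma arc_FA_clears_unit_discs: "successively (clears_unit_discs (pt (-1/2) (13/58)) (pt 0 (-1))) arc_FA"
  by (simp add: arc_FA_def clears_unit_discs_pt Let_def power2_eq_square)

lemma arc_AB_clears_unit_discs: "successively (clears_unit_discs (pt (-13/100) (-87/100)) (pt (-1) 1)) arc_AB"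
  by (simp add: arc_AB_def clears_unit_discs_pt Let_def power2_eq_square)

lemma placed_subset_arc_FA:
  assumes "placed K"
  shows "K \<subseteq> polygon arc_FA"
proof -
  have "inscribed K"
    using assms by (simp add: placed_def)
  then obtain v where v: "pt (-1/2) v \<in> K"
    by (rule inscribed_contact_CD)
  then have "pt (-1/2) v \<bullet> cut_normal_C \<le> 1/2"
    using assms by (simp add: placed_def avoids_def)
  then have "v \<le> 13/58"
    by (simp add: cut_normal_C_def inner_pt field_simps)
  with \<open>inscribed K\<close> v show ?thesis
    using arc_FA_clears_unit_discs by (rule inscribed_clears_CD)
qed

lemma placed_subset_arc_AB:
  assumes "placed K"
  shows "K \<subseteq> polygon arc_AB"
proof -
  have "inscribed K"
    using assms by (simp add: placed_def)
  then obtain u where u: "pt u (- 1 - u) \<in> K"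
    by (rule inscribed_contact_DE)
  then have "pt u (- 1 - u) \<bullet> cut_normal_E \<le> 1/2"
    using assms by (simp add: placed_def avoids_def)
  then have "u \<le> -13/100"
    by (simp add: cut_normal_E_def inner_pt field_simps)
  with \<open>inscribed K\<close> u show ?thesis
    using arc_AB_clears_unit_discs by (intro inscribed_clears_DE[of K u "-13/100"]) simp_all
qed

lemma placed_subset_flat_part:
  assumes "placed K"
  shows "K \<subseteq> polygon flat_part \<inter> left_of (last flat_part) (hd arc_FA) \<inter> left_of (last arc_AB) (pt 0 1)"
proof
  fix x assume x: "x \<in> K"
  obtain u v where uv: "x = pt u v"
    by (rule pt_exhaust)
  have "x \<bullet> cut_normal_C \<le> 1/2" "x \<bullet> cut_normal_E \<le> 1/2" "x \<in> regular_hexagon"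
    using assms x by (auto simp: placed_def inscribed_def avoids_def)
  then show "x \<in> polygon flat_part \<inter> left_of (last flat_part) (hd arc_FA) \<inter> left_of (last arc_AB) (pt 0 1)"
    unfolding uv cut_normal_C_def cut_normal_E_def inner_pt pt_in_regular_hexagon_iff abs_le_iff
    by (simp add: polygon_def flat_part_def arc_FA_def arc_AB_def left_of_pt) argo
qed

lemma left_of_bridge_eq: "left_of (last arc_FA) (hd arc_AB) = left_of (pt 0.488322 0.488313) (pt 0.450136 0.540791)"
  by (simp add: arc_FA_def arc_AB_def)

lemma avoids_A_subset_bridge:
  assumes "inscribed K" "avoids K (- reflect cut_normal_C)"
  shows "K \<subseteq> left_of (last arc_FA) (hd arc_AB)"
proof
  fix x assume x: "x \<in> K"
  obtain u v where uv: "x = pt u v"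
    by (rule pt_exhaust)
  have "x \<bullet> - reflect cut_normal_C \<le> 1/2" "x \<in> regular_hexagon"
    using assms x by (auto simp: inscribed_def avoids_def)
  then show "x \<in> left_of (last arc_FA) (hd arc_AB)"
    unfolding left_of_bridge_eq
    by (simp add: uv cut_normal_C_def reflect_pt pt_minus inner_pt pt_in_regular_hexagon_iff abs_le_iff
        left_of_pt field_simps)
qed

lemma avoids_E_subset_bridge:
  assumes K: "inscribed K" and avoids: "avoids K (- reflect cut_normal_E)"
  shows "K \<subseteq> left_of (last arc_FA) (hd arc_AB)"
proof -
  obtain u where u: "pt u (- 1 - u) \<in> K"
    using inscribed_contact_DE[OF K] .
  then have "pt u (- 1 - u) \<bullet> - reflect cut_normal_E \<le> 1/2"
    using avoids by (simp add: avoids_def)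
  then have "u \<le> -4/29"
    by (simp add: cut_normal_E_def reflect_pt pt_minus inner_pt field_simps)
  with K u have "K \<subseteq> polygon [pt 0.488322 0.488313, pt 0.450136 0.540791]"
    by (rule inscribed_clears_DE) (simp add: clears_unit_discs_pt Let_def power2_eq_square)
  then show ?thesis
    unfolding left_of_bridge_eq by (simp add: polygon_def)
qed

lemma contact_CD_subset_bridge:
  assumes K: "inscribed K" "K \<subseteq> polygon arc_AB" and v: "pt (-1/2) v \<in> K" "v \<le> 0"
  shows "K \<subseteq> left_of (last arc_FA) (hd arc_AB)"
proof -
  \<comment> \<open>\<open>?p\<close> is chosen such that \<open>?p ?q\<close> passes just outside the unit disc about the midpoint of \<open>CD\<close>\<close>
  let ?p = "pt 0.451558 0.5335725" and ?q = "pt 0.450136 0.540791" and ?r = "pt 0.444480 0.547754"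
  have "K \<subseteq> polygon [?p, ?q]"
    using K(1) v by (rule inscribed_clears_CD) (simp add: clears_unit_discs_pt Let_def power2_eq_square)
  then have "K \<subseteq> left_of ?p ?q"
    by (simp add: polygon_def)
  moreover have "K \<subseteq> left_of ?q ?r"
    using K(2) by (auto simp: arc_AB_def polygon_Cons_Cons)
  moreover have "left_of ?p ?q \<inter> left_of ?q ?r \<subseteq> left_of (pt 0.488322 0.488313) ?q"
    by (rule left_of_combination[where c = "13/2"]) (simp_all add: pt_diff pt_add pt_scaleR)
  ultimately show ?thesis
    unfolding left_of_bridge_eq by blast
qed

lemma placed_subset_bridge:
  assumes K: "placed K"
  shows "K \<subseteq> left_of (last arc_FA) (hd arc_AB)"
proof -
  have "inscribed K"
    using K by (simp add: placed_def)
  consider "avoids K (- reflect cut_normal_C)" | "avoids K (- reflect cut_normal_E)"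
    | v where "pt (-1/2) v \<in> K" "v \<le> 0"
    using K by (auto simp: placed_def)
  then show ?thesis
    using avoids_A_subset_bridge avoids_E_subset_bridge contact_CD_subset_bridge
      placed_subset_arc_AB[OF K] \<open>inscribed K\<close>
    by cases metis+
qed

definition cover :: "(real^2) set" where
  "cover = polygon cover_vertices"

lemma placed_subset_cover:
  assumes "placed K"
  shows "K \<subseteq> cover"
proof -
  have "flat_part \<noteq> []" "arc_FA \<noteq> []" "arc_AB \<noteq> []" "polygon [pt 0 1] = UNIV"
    by (simp_all add: flat_part_def arc_FA_def arc_AB_def polygon_def)
  then have cover_eq: "cover = polygon flat_part \<inter> left_of (last flat_part) (hd arc_FA) \<inter> polygon arc_FA
      \<inter> left_of (last arc_FA) (hd arc_AB) \<inter> polygon arc_AB \<inter> left_of (last arc_AB) (pt 0 1)"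
    by (auto simp: cover_def cover_vertices_def polygon_append)
  show ?thesis
    unfolding cover_eq
    using placed_subset_flat_part[OF assms] placed_subset_arc_FA[OF assms] placed_subset_bridge[OF assms]
      placed_subset_arc_AB[OF assms]
    by simp
qed

lemma cover_vertices_turning: "successively (\<lambda>p q. 0 < cross2 p q) cover_vertices"
  by (simp add: cover_vertices_def flat_part_def arc_FA_def arc_AB_def cross2_pt)

lemma sum_cross2_cover_vertices:
  "(\<Sum>(p, q)\<leftarrow>edges cover_vertices. cross2 p q) = 16959777511881/5800000000000 / sqrt 3"
  by (simp add: cover_vertices_def flat_part_def arc_FA_def arc_AB_def cross2_pt)

lemma emeasure_cover: "emeasure lebesgue cover \<le> ennreal 0.8441153"
proof -
  have "1.732050 \<le> sqrt 3"
    by (rule real_le_rsqrt) (simp add: power2_eq_square)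
  then have "16959777511881/5800000000000 / sqrt 3 / 2 \<le> 0.8441153"
    by (simp add: field_simps)
  then have "ennreal ((\<Sum>(p, q)\<leftarrow>edges cover_vertices. cross2 p q) / 2) \<le> ennreal 0.8441153"
    unfolding sum_cross2_cover_vertices by (rule ennreal_leI)
  moreover have "emeasure lebesgue cover \<le> ennreal ((\<Sum>(p, q)\<leftarrow>edges cover_vertices. cross2 p q) / 2)"
    unfolding cover_def using cover_vertices_turning
    by (rule emeasure_polygon_le[rotated]) (simp add: cover_vertices_def flat_part_def)
  ultimately show ?thesis by (rule order_trans[rotated])
qed

lemma dist_le_diam: "x \<in> A \<Longrightarrow> y \<in> A \<Longrightarrow> ereal (dist x y) \<le> diam A"
  unfolding diam_def by (intro SUP_upper2[of "(x, y)"]) auto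

lemma diam_one_into_placed:
  assumes "diam A = 1"
  obtains f K where "rigid_motion f" "f ` A \<subseteq> K" "placed K"
proof -
  have "dist x y \<le> 1" if "x \<in> A" "y \<in> A" for x y
    using dist_le_diam[OF that] assms by simp
  then obtain K where K: "A \<subseteq> K" "constant_width 1 K"
    using constant_width_extension[of 1 A] by auto
  obtain f where f: "rigid_motion f" "f ` K \<subseteq> regular_hexagon"
    using circumscribed_regular_hexagon[OF K(2)] .
  then have "inscribed (f ` K)"
    using K(2) by (simp add: inscribed_def constant_width_rigid_motion)
  then obtain g where g: "rigid_motion g" "placed (g ` f ` K)"
    by (rule inscribed_placement)
  show thesis
  proof
    show "rigid_motion (g \<circ> f)"
      using g(1) f(1) by (rule rigid_motion_compose)
    show "(g \<circ> f) ` A \<subseteq> g ` f ` K"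
      using K(1) by auto
  qed (rule g(2))
qed

theorem mainTheorem1:
  shows "\<exists>U. universal_covering U \<and> U \<in> sets lebesgue \<and>
           emeasure lebesgue U \<le> ennreal 0.8441153"
proof (intro exI[of _ cover] conjI)
  have "\<exists>f. plane_isometry f \<and> f ` A \<subseteq> cover" if "diam A = 1" for A
    using diam_one_into_placed[OF that] placed_subset_cover plane_isometry_rigid_motion
    by (metis order_trans)
  then show "universal_covering cover"
    by (simp add: universal_covering_def cover_def convex_polygon)
  show "cover \<in> sets lebesgue"
    by (simp add: cover_def closed_polygon lebesgue_closedin)
  show "emeasure lebesgue cover \<le> ennreal 0.8441153"
    by (rule emeasure_cover)
qed

end
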